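(* For any integers $d, r \geq 0$ and for every string graph $G$ in the plane with maximum density at most $d$, $$\nabla_r(G) \leq 3e\big((2r + 2) d + 1\big),$$ where $e$ is the base of the natural logarithm.
   Context: Graphs are finite, simple and undirected. A string graph $G$ in the plane is the intersection graph of a finite collection $\mathcal{C}$ of non-self-intersecting continuous curves (strings) in the plane: the vertices of $G$ are represented by the curves of $\mathcal{C}$, and two distinct vertices are adjacent if and only if the corresponding curves intersect. The edge density of a graph $G$ is $|E(G)|/|V(G)|$ if $V(G)\neq\emptyset$, and is $0$ if $V(G)=\emptyset$. The maximum density of $G$ is the maximum edge density of a subgraph of $G$. A model of a graph $J$ in a graph $G$ is a collection $(S_i : i\in V(J))$ of pairwise disjoint non-empty subsets of $V(G)$ such that each induced subgraph $G[S_i]$ is connected and for every edge $ij\in E(J)$ there is an edge of $G$ between $S_i$ and $S_j$. The radius of a connected graph $S$ is the minimum integer $r\geq 0$ such that for some vertex $c\in V(S)$, $\mathrm{dist}_S(c,w)\leq r$ for every $w\in V(S)$. The model is $r$-shallow if each $G[S_i]$ has radius at most $r$. $J$ is an $r$-shallow minor of $G$ if there is an $r$-shallow model of $J$ in $G$. $\nabla_r(G)$ is the maximum edge density of an $r$-shallow minor of $G$. *)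

theory Defs
  imports "HOL-Analysis.Analysis" "HOL-Library.Disjoint_Sets"
begin

type_synonym 'a ugraph = "'a set \<times> 'a set set"

abbreviation verts :: "'a ugraph \<Rightarrow> 'a set" where
  "verts G \<equiv> fst G"

abbreviation edges :: "'a ugraph \<Rightarrow> 'a set set" where
  "edges G \<equiv> snd G"

definition simple_graph :: "'a ugraph \<Rightarrow> bool" where
  "simple_graph G \<longleftrightarrow> finite (verts G) \<and> (\<forall>e\<in>edges G. e \<subseteq> verts G \<and> card e = 2)"

definition subgraph :: "'a ugraph \<Rightarrow> 'a ugraph \<Rightarrow> bool" where
  "subgraph H G \<longleftrightarrow> simple_graph H \<and> verts H \<subseteq> verts G \<and> edges H \<subseteq> edges G"

definition induced_subgraph :: "'a ugraph \<Rightarrow> 'a set \<Rightarrow> 'a ugraph" where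
  "induced_subgraph G S = (S \<inter> verts G, {e \<in> edges G. e \<subseteq> S})"

definition edge_density :: "'a ugraph \<Rightarrow> real" where
  "edge_density G = (if verts G = {} then 0 else real (card (edges G)) / real (card (verts G)))"

definition max_density :: "'a ugraph \<Rightarrow> real" where
  "max_density G = Max (edge_density ` {H. subgraph H G})"

definition walk_betw :: "'a ugraph \<Rightarrow> 'a \<Rightarrow> 'a list \<Rightarrow> 'a \<Rightarrow> bool" where
  "walk_betw G u p v \<longleftrightarrow>
     p \<noteq> [] \<and> hd p = u \<and> last p = v \<and> set p \<subseteq> verts G \<and>
     successively (\<lambda>x y. {x, y} \<in> edges G) p"

definition connected_graph :: "'a ugraph \<Rightarrow> bool" where
  "connected_graph G \<longleftrightarrow>
     verts G \<noteq> {} \<and> (\<forall>u\<in>verts G. \<forall>v\<in>verts G. \<exists>p. walk_betw G u p v)"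

text \<open>Both \<open>graph_dist\<close> and \<open>graph_radius\<close> are only meaningful for connected graphs.\<close>

definition graph_dist :: "'a ugraph \<Rightarrow> 'a \<Rightarrow> 'a \<Rightarrow> nat" where
  "graph_dist G u v = (LEAST n. \<exists>p. walk_betw G u p v \<and> length p = Suc n)"

definition graph_radius :: "'a ugraph \<Rightarrow> nat" where
  "graph_radius G = (LEAST r. \<exists>c\<in>verts G. \<forall>w\<in>verts G. graph_dist G c w \<le> r)"

definition is_model :: "'b ugraph \<Rightarrow> 'a ugraph \<Rightarrow> ('b \<Rightarrow> 'a set) \<Rightarrow> bool" where
  "is_model J G S \<longleftrightarrow>
     (\<forall>i\<in>verts J. S i \<noteq> {} \<and> S i \<subseteq> verts G \<and> connected_graph (induced_subgraph G (S i))) \<and>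
     disjoint_family_on S (verts J) \<and>
     (\<forall>i j. {i, j} \<in> edges J \<longrightarrow> (\<exists>u\<in>S i. \<exists>v\<in>S j. {u, v} \<in> edges G))"

definition shallow_model :: "nat \<Rightarrow> 'b ugraph \<Rightarrow> 'a ugraph \<Rightarrow> ('b \<Rightarrow> 'a set) \<Rightarrow> bool" where
  "shallow_model r J G S \<longleftrightarrow>
     is_model J G S \<and> (\<forall>i\<in>verts J. graph_radius (induced_subgraph G (S i)) \<le> r)"

definition shallow_minor :: "nat \<Rightarrow> 'b ugraph \<Rightarrow> 'a ugraph \<Rightarrow> bool" where
  "shallow_minor r J G \<longleftrightarrow> simple_graph J \<and> (\<exists>S. shallow_model r J G S)"

text \<open>A definition cannot quantify over the vertex type of \<open>J\<close>. Natural number vertices lose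
  nothing, as every finite graph is isomorphic to one of these.\<close>

definition nabla :: "nat \<Rightarrow> 'a ugraph \<Rightarrow> real" where
  "nabla r G = Max (edge_density ` {J :: nat ugraph. shallow_minor r J G})"

text \<open>The plane is \<^typ>\<open>complex\<close>, and a string is an \<^const>\<open>arc\<close>, i.e. a continuous curve that is
  injective on \<open>[0,1]\<close>. The curves are given as a family indexed by the vertices.\<close>

definition string_graph :: "'a ugraph \<Rightarrow> bool" where
  "string_graph G \<longleftrightarrow> simple_graph G \<and>
     (\<exists>\<gamma> :: 'a \<Rightarrow> real \<Rightarrow> complex.
        (\<forall>v\<in>verts G. arc (\<gamma> v)) \<and>
        (\<forall>u\<in>verts G. \<forall>v\<in>verts G. u \<noteq> v \<longrightarrow>
           ({u, v} \<in> edges G \<longleftrightarrow> path_image (\<gamma> u) \<inter> path_image (\<gamma> v) \<noteq> {})))"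

text \<open>\<^const>\<open>Max\<close> is unspecified on infinite or empty sets, so both must be excluded above.\<close>

lemma edge_density_eq: "edge_density G = real (card (edges G)) / real (card (verts G))"
  by (simp add: edge_density_def)

lemma simple_graph_empty: "simple_graph ({}, {})"
  by (simp add: simple_graph_def)

lemma max_density_wf:
  assumes "simple_graph G"
  shows "finite (edge_density ` {H. subgraph H G})" "edge_density ` {H. subgraph H G} \<noteq> {}"
proof -
  have "edges G \<subseteq> Pow (verts G)" "finite (verts G)"
    using assms by (auto simp: simple_graph_def)
  then have "finite (Pow (verts G) \<times> Pow (edges G))"
    by (meson finite_Pow_iff finite_SigmaI finite_subset)
  moreover have "{H. subgraph H G} \<subseteq> Pow (verts G) \<times> Pow (edges G)"
    by (auto simp: subgraph_def)
  ultimately show "finite (edge_density ` {H. subgraph H G})"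
    by (meson finite_imageI finite_subset)
  have "subgraph ({}, {}) G"
    by (simp add: subgraph_def simple_graph_empty)
  then show "edge_density ` {H. subgraph H G} \<noteq> {}" by blast
qed

lemma nabla_wf:
  fixes G :: "'a ugraph"
  assumes "simple_graph G"
  shows "finite (edge_density ` {J :: nat ugraph. shallow_minor r J G})"
    "edge_density ` {J :: nat ugraph. shallow_minor r J G} \<noteq> {}"
proof -
  define N where "N = card (verts G)"
  have "edge_density J \<in> (\<lambda>(m, n). real m / real n) ` ({..2 ^ N} \<times> {..N})"
    if J: "shallow_minor r J G" for J :: "nat ugraph"
  proof -
    have fin: "finite (verts J)" and sub: "edges J \<subseteq> Pow (verts J)"
      using J by (auto simp: shallow_minor_def simple_graph_def)
    obtain S where "is_model J G S"
      using J unfolding shallow_minor_def shallow_model_def by blast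
    then have S: "\<And>i. i \<in> verts J \<Longrightarrow> S i \<noteq> {} \<and> S i \<subseteq> verts G"
      and dis: "disjoint_family_on S (verts J)"
      by (simp_all add: is_model_def)
    have S': "(SOME x. x \<in> S i) \<in> S i" if "i \<in> verts J" for i
      using S[OF that] some_in_eq by blast
    have "inj_on (\<lambda>i. SOME x. x \<in> S i) (verts J)"
      by (rule inj_onI) (metis S' dis disjoint_family_on_def disjoint_iff)
    moreover have "(\<lambda>i. SOME x. x \<in> S i) ` verts J \<subseteq> verts G"
      using S S' by blast
    ultimately have n: "card (verts J) \<le> N"
      unfolding N_def using assms by (intro card_inj_on_le) (auto simp: simple_graph_def)
    have "card (edges J) \<le> 2 ^ card (verts J)"
      using card_mono[OF _ sub] fin by (simp add: card_Pow)
    also have "\<dots> \<le> 2 ^ N" using n by simp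
    finally have "(card (edges J), card (verts J)) \<in> {..2 ^ N} \<times> {..N}" using n by simp
    then show ?thesis unfolding edge_density_eq by (rule rev_image_eqI) simp
  qed
  then have "edge_density ` {J :: nat ugraph. shallow_minor r J G}
      \<subseteq> (\<lambda>(m, n). real m / real n) ` ({..2 ^ N} \<times> {..N})" by blast
  then show "finite (edge_density ` {J :: nat ugraph. shallow_minor r J G})"
    by (rule finite_subset) simp
  have "shallow_minor r (({}, {}) :: nat ugraph) G"
    by (simp add: shallow_minor_def simple_graph_empty shallow_model_def is_model_def
        disjoint_family_on_def)
  then show "edge_density ` {J :: nat ugraph. shallow_minor r J G} \<noteq> {}" by blast
qed

end

theory Submission
  imports Defs "HOL-Complex_Analysis.Riemann_Mapping"
begin

text \<open>
  Let \<open>S\<close> be an \<open>r\<close>-shallow model of \<open>J\<close>. Every edge \<open>e\<close> of \<open>J\<close> is realised by a path in \<open>G\<close> on at most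
  \<open>2r + 2\<close> strings that joins the centres of two branch sets. Since \<open>G\<close> has maximum density at most
  \<open>d\<close>, it has an orientation with outdegrees at most \<open>d\<close>, so at most \<open>m = (2r + 2)d\<close> further branch
  sets are hit by arcs leaving this path. Choose vertices of \<open>J\<close> at random with probability
  \<open>1/(m + 1)\<close> and keep \<open>e\<close> if both its ends are chosen and none of these further branch sets is.
  Kept edges without a common end follow strings that do not meet, because an intersection would be
  an arc leaving one of the two paths. A graph drawn in this way has fewer than \<open>3n\<close> edges: the
  property survives contractions and fails for \<open>K\<^sub>5\<close>, so Mader's argument applies. Comparing
  expectations as in the Clarkson-Shor method gives the bound.
\<close>

section \<open>Drawings of the complete graph on five vertices\<close>

text \<open>The values of \<open>g - h\<close> differ only by integer multiples of
  \<open>2 * pi * \<i>\<close>, and a continuous function with such discrete range is constant on a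
  connected set.\<close>

lemma continuous_logs_same_increment:
  fixes g h :: "'a::real_normed_vector \<Rightarrow> complex"
  assumes "connected S" "continuous_on S g" "continuous_on S h"
    and eq: "\<And>x. x \<in> S \<Longrightarrow> exp (g x) = c * exp (h x)" and "x \<in> S" "y \<in> S"
  shows "g x - g y = h x - h y"
proof -
  define k where "k = (\<lambda>x. (g x - h x) / (2 * pi * \<i>))"
  have int: "k x - k y \<in> \<int>" if "x \<in> S" "y \<in> S" for x y
  proof -
    have "exp (g x) \<noteq> 0" by simp
    then have "c \<noteq> 0" using eq[OF that(1)] by auto
    have "exp (g x - h x) = exp (g y - h y)"
      using eq that by (simp add: exp_diff)
    then obtain n :: int where "g x - h x = g y - h y + (of_int (2 * n) * pi) * \<i>"
      unfolding exp_eq by blast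
    then have "g x - h x - (g y - h y) = of_int n * (2 * pi * \<i>)"
      by simp
    then have "k x - k y = of_int n"
      unfolding k_def diff_divide_distrib[symmetric] by simp
    then show ?thesis by simp
  qed
  have "k constant_on S"
  proof (rule continuous_discrete_range_constant[OF assms(1)])
    show "continuous_on S k"
      unfolding k_def by (intro continuous_intros assms) auto
    show "\<exists>e>0. \<forall>y. y \<in> S \<and> k y \<noteq> k x \<longrightarrow> e \<le> norm (k y - k x)" if "x \<in> S" for x
    proof (intro exI[of _ 1] conjI allI impI)
      fix y assume y: "y \<in> S \<and> k y \<noteq> k x"
      then obtain n :: int where n: "k y - k x = of_int n"
        using int[of y x] \<open>x \<in> S\<close> unfolding Ints_def by blast
      with y have "n \<noteq> 0" by auto
      then show "1 \<le> norm (k y - k x)"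
        unfolding n norm_of_int by linarith
    qed simp
  qed
  then have "k x = k y"
    using assms(5,6) unfolding constant_on_def by metis
  then show ?thesis by (simp add: k_def algebra_simps)
qed

text \<open>The factor \<open>c\<close> lets a single logarithm of \<open>q t - p s\<close> serve
  two paths: \<open>c = 1\<close> for \<open>q\<close> about \<open>p s\<close>, and
  \<open>c = -1\<close> for \<open>p\<close> about \<open>q t\<close>.\<close>

lemma winding_number_eq_log_increment:
  assumes "path p" "z \<notin> path_image p" "continuous_on {0..1} g"
    and "\<And>t. t \<in> {0..1} \<Longrightarrow> c * (p t - z) = exp (g t)"
  shows "g 1 - g 0 = 2 * pi * \<i> * winding_number p z"
proof -
  obtain q where q: "path q" "pathfinish q - pathstart q = 2 * of_real pi * \<i> * winding_number p z"
    "\<And>t. t \<in> {0..1} \<Longrightarrow> p t = z + exp (q t)"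
    using winding_number_as_continuous_log[OF assms(1,2)] by blast
  have "g 1 - g 0 = q 1 - q 0"
    using assms(4) q(3)
    by (intro continuous_logs_same_increment[of "{0..1::real}" _ _ c])
      (use q(1) assms(3) in \<open>auto simp: path_def\<close>)
  then show ?thesis using q(2) by (simp add: pathfinish_def pathstart_def)
qed

text \<open>Follow a continuous logarithm of \<open>q t - p s\<close> around the boundary of the unit square.\<close>

lemma winding_number_disjoint_paths:
  assumes "path p" "path q" "path_image p \<inter> path_image q = {}"
  shows "winding_number q (pathstart p) - winding_number q (pathfinish p) =
    winding_number p (pathstart q) - winding_number p (pathfinish q)"
proof -
  let ?S = "{0..1::real} \<times> {0..1::real}"
  have cp: "continuous_on {0..1} p" "continuous_on {0..1} q"
    using assms by (auto simp: path_def)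
  have off: "p s \<notin> path_image q" "q s \<notin> path_image p" if "s \<in> {0..1}" for s
    using assms(3) that unfolding path_image_def by blast+
  have ne: "q t - p s \<noteq> 0" if "s \<in> {0..1}" "t \<in> {0..1}" for s t
    using off(1)[OF that(1)] that(2) unfolding path_image_def by (metis eq_iff_diff_eq_0 image_eqI)
  have "continuous_on ?S (\<lambda>x. q (snd x) - p (fst x))"
    by (intro continuous_intros continuous_on_compose2[OF cp(1)] continuous_on_compose2[OF cp(2)]) auto
  moreover have "contractible ?S"
    by (intro convex_imp_contractible convex_Times) auto
  moreover have "q (snd x) - p (fst x) \<noteq> 0" if "x \<in> ?S" for x
    using ne that by auto
  ultimately obtain L where L: "continuous_on ?S L"
    "\<And>x. x \<in> ?S \<Longrightarrow> q (snd x) - p (fst x) = exp (L x)"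
    by (rule continuous_logarithm_on_contractible) (assumption, rule that)
  have 1: "L (s, 1) - L (s, 0) = 2 * pi * \<i> * winding_number q (p s)" if "s \<in> {0..1}" for s
    by (rule winding_number_eq_log_increment[OF assms(2), of _ "\<lambda>t. L (s, t)" 1])
      (use that off L(2)[of "(s, _)"] in
        \<open>auto intro!: continuous_on_compose2[OF L(1)] continuous_intros\<close>)
  have 2: "L (1, t) - L (0, t) = 2 * pi * \<i> * winding_number p (q t)" if "t \<in> {0..1}" for t
    by (rule winding_number_eq_log_increment[OF assms(1), of _ "\<lambda>s. L (s, t)" "-1"])
      (use that off L(2)[of "(_, t)"] in
        \<open>auto intro!: continuous_on_compose2[OF L(1)] continuous_intros\<close>)
  have "2 * pi * \<i> * (winding_number q (p 0) - winding_number q (p 1)) =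
      2 * pi * \<i> * (winding_number p (q 0) - winding_number p (q 1))"
    using 1[of 0] 1[of 1] 2[of 0] 2[of 1] by (simp add: algebra_simps)
  then show ?thesis
    by (simp add: pathstart_def pathfinish_def)
qed

text \<open>Up to an integer, the winding number of the path from \<open>q c\<close> to \<open>q d\<close> about \<open>q x\<close> is
  \<open>l x d - l x c\<close>, where \<open>l\<close> is a logarithm of \<open>q y - q x\<close> divided by \<open>2 \<pi> i\<close>. Swapping the arguments
  of \<open>l\<close> adds 1/2, so the square identity for a pair of disjoint edges becomes an integer equation
  with right-hand side -1 if the endpoints interleave and 0 otherwise. Over all 15 pairs every integer
  unknown occurs twice while 5 pairs interleave, a contradiction modulo 2.\<close>

lemma K5_drawing_impossible:
  fixes q :: "nat \<Rightarrow> complex" and D :: "nat \<Rightarrow> nat \<Rightarrow> complex set"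
  assumes D: "\<And>i j. i < j \<Longrightarrow> j < 5 \<Longrightarrow> path_connected (D i j) \<and> q i \<in> D i j \<and> q j \<in> D i j"
    and disj: "\<And>i j k l. i < j \<Longrightarrow> k < l \<Longrightarrow> j < 5 \<Longrightarrow> l < 5 \<Longrightarrow> {i, j} \<inter> {k, l} = {} \<Longrightarrow>
      D i j \<inter> D k l = {}"
  shows False
proof -
  have "\<exists>g. path g \<and> path_image g \<subseteq> D i j \<and> pathstart g = q i \<and> pathfinish g = q j"
    if "i < j" "j < 5" for i j
    using D[OF that] unfolding path_connected_def by blast
  then obtain g where g: "\<And>i j. i < j \<Longrightarrow> j < 5 \<Longrightarrow>
    path (g i j) \<and> path_image (g i j) \<subseteq> D i j \<and> pathstart (g i j) = q i \<and> pathfinish (g i j) = q j"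
    by metis
  \<comment> \<open>Both orders of a pair use the same value of \<open>Ln\<close>, so a swap adds
    exactly 1/2 and not merely 1/2 modulo integers.\<close>
  define l where "l = (\<lambda>x y. if x < y then Ln (q y - q x) / (2 * pi * \<i>)
    else Ln (q x - q y) / (2 * pi * \<i>) + 1 / 2)"
  have l_swap: "l y x = l x y + 1 / 2" if "x < y" for x y
    using that by (simp add: l_def)
  have qD: "q x \<in> D (min x z) (max x z)" if "x < 5" "z < 5" "x \<noteq> z" for x z
    using D[of "min x z" "max x z"] that by (auto simp: min_def max_def split: if_splits)
  have qne: "q x \<noteq> q y" if "x < 5" "y < 5" "x \<noteq> y" for x y
  proof -
    \<comment> \<open>The edges \<open>x z\<close> and \<open>y w\<close> have no common end, so
      their drawings are disjoint and the points \<open>q x\<close>, \<open>q y\<close> on them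
      differ.\<close>
    have "\<exists>z w. z < 5 \<and> w < 5 \<and> z \<noteq> w \<and> z \<noteq> x \<and> w \<noteq> x \<and> z \<noteq> y \<and> w \<noteq> (y::nat)"
      using that by presburger
    then obtain z w where zw: "z < 5" "w < 5" "z \<noteq> w" "z \<noteq> x" "w \<noteq> x" "z \<noteq> y" "w \<noteq> y" by blast
    have "D (min x z) (max x z) \<inter> D (min y w) (max y w) = {}"
      by (rule disj) (use that zw in \<open>auto simp: min_def max_def\<close>)
    then show ?thesis
      using qD[of x z] qD[of y w] that zw by auto
  qed
  have exp_l: "exp (2 * pi * \<i> * l x y) = q y - q x" if "x < 5" "y < 5" "x \<noteq> y" for x y
  proof (cases "x < y")
    case True
    then show ?thesis using qne[OF that] by (simp add: l_def)
  next
    case False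
    then have "2 * pi * \<i> * l x y = Ln (q x - q y) + pi * \<i>"
      by (simp add: l_def distrib_left)
    then show ?thesis using qne[OF that] by (simp add: exp_add)
  qed
  have q_off: "q x \<notin> path_image (g c d)" if "x < 5" "c < d" "d < 5" "x \<noteq> c" "x \<noteq> d" for x c d
  proof -
    have "\<exists>z. z < 5 \<and> z \<noteq> x \<and> z \<noteq> c \<and> z \<noteq> d"
      using that by presburger
    then obtain z where z: "z < 5" "z \<noteq> x" "z \<noteq> c" "z \<noteq> d" by blast
    have "D (min x z) (max x z) \<inter> D c d = {}"
      by (rule disj) (use that z in \<open>auto simp: min_def max_def\<close>)
    then show ?thesis using qD[of x z] g[of c d] that z by auto
  qed
  have "\<exists>n::int. winding_number (g c d) (q x) = l x d - l x c + of_int n"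
    if "x < 5" "c < d" "d < 5" "x \<noteq> c" "x \<noteq> d" for x c d
  proof -
    let ?w = "winding_number (g c d) (q x)"
    have "q d - q x = exp (2 * pi * \<i> * ?w) * (q c - q x)"
      using winding_number_exp_2pi[of "g c d" "q x"] g[of c d] q_off[OF that] that by simp
    then have "exp (2 * pi * \<i> * l x d) = exp (2 * pi * \<i> * ?w + 2 * pi * \<i> * l x c)"
      using exp_l that by (simp add: exp_add)
    then obtain n :: int where
      "2 * pi * \<i> * l x d = 2 * pi * \<i> * ?w + 2 * pi * \<i> * l x c + (of_int (2 * n) * pi) * \<i>"
      unfolding exp_eq by blast
    then have "2 * pi * \<i> * l x d = 2 * pi * \<i> * (?w + l x c + of_int n)"
      by (simp add: algebra_simps)
    then have "l x d = ?w + l x c + of_int n" by simp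
    then show ?thesis by (intro exI[of _ "-n"]) simp
  qed
  then obtain n :: "nat \<Rightarrow> nat \<Rightarrow> nat \<Rightarrow> int" where
    n: "\<And>x c d. x < 5 \<Longrightarrow> c < d \<Longrightarrow> d < 5 \<Longrightarrow> x \<noteq> c \<Longrightarrow> x \<noteq> d \<Longrightarrow>
      winding_number (g c d) (q x) = l x d - l x c + of_int (n x c d)"
    by metis
  \<comment> \<open>In the square identity the winding numbers cancel; what remains of the
    logarithms are four swaps, each contributing 1/2 or -1/2 according to the order of its two
    vertices.\<close>
  have main: "of_int (n a c d - n b c d - n c a b + n d a b) =
      (l c b - l b c) - (l c a - l a c) - (l d b - l b d) + (l d a - l a d)"
    if "a < b" "c < d" "b < 5" "d < 5" "{a, b} \<inter> {c, d} = {}" for a b c d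
  proof -
    have "D a b \<inter> D c d = {}" using disj that by blast
    then have w: "winding_number (g c d) (q a) - winding_number (g c d) (q b) =
        winding_number (g a b) (q c) - winding_number (g a b) (q d)"
      using winding_number_disjoint_paths[of "g a b" "g c d"] g[of a b] g[of c d] that by auto
    have "of_int (n x i j) = winding_number (g i j) (q x) - l x j + l x i"
      if "x < 5" "i < j" "j < 5" "x \<noteq> i" "x \<noteq> j" for x i j
      using n[OF that] by simp
    then have N: "of_int (n a c d) = winding_number (g c d) (q a) - l a d + l a c"
      "of_int (n b c d) = winding_number (g c d) (q b) - l b d + l b c"
      "of_int (n c a b) = winding_number (g a b) (q c) - l c b + l c a"
      "of_int (n d a b) = winding_number (g a b) (q d) - l d b + l d a"
      using that by auto
    have "of_int (n a c d - n b c d - n c a b + n d a b) =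
      (winding_number (g c d) (q a) - winding_number (g c d) (q b)) -
      (winding_number (g a b) (q c) - winding_number (g a b) (q d)) +
      ((l c b - l b c) - (l c a - l a c) - (l d b - l b d) + (l d a - l a d))"
      by (simp add: N algebra_simps)
    then show ?thesis unfolding w by simp
  qed
  \<comment> \<open>The three ways to split four vertices \<open>a < b < c < d\<close> into two
    edges.\<close>
  have nested: "n a b c - n d b c - n b a d + n c a d = 0"
    and crossing: "n a b d - n c b d - n b a c + n d a c = -1"
    and separate: "n a c d - n b c d - n c a b + n d a b = 0"
    if "a < b" "b < c" "c < d" "d < 5" for a b c d
  proof -
    have "of_int (n a b c - n d b c - n b a d + n c a d) = (of_int 0 :: complex)"
      using that by (subst main) (auto simp: l_swap)
    then show "n a b c - n d b c - n b a d + n c a d = 0" by (simp only: of_int_eq_iff)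
    have "of_int (n a b d - n c b d - n b a c + n d a c) = (of_int (-1) :: complex)"
      using that by (subst main) (auto simp: l_swap)
    then show "n a b d - n c b d - n b a c + n d a c = -1" by (simp only: of_int_eq_iff)
    have "of_int (n a c d - n b c d - n c a b + n d a b) = (of_int 0 :: complex)"
      using that by (subst main) (auto simp: l_swap)
    then show "n a c d - n b c d - n c a b + n d a b = 0" by (simp only: of_int_eq_iff)
  qed
  \<comment> \<open>The sum of all fifteen equations: of the thirty unknowns, ten occur with
    opposite signs and cancel, the other twenty occur twice with equal sign.\<close>
  have "2 * (n 0 1 2 + n 0 1 3 + n 0 1 4 + n 0 2 3 + n 0 2 4 + n 0 3 4 - n 1 0 2 - n 1 0 3 - n 1 0 4 - n 2 0 1 - n 2 1 3 - n 2 1 4 - n 2 3 4 + n 3 0 4 - n 3 1 2 - n 3 2 4 + n 4 0 1 + n 4 0 2 + n 4 0 3 - n 4 2 3) = - 5"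
    using nested[of 0 1 2 3] crossing[of 0 1 2 3] separate[of 0 1 2 3]
      nested[of 0 1 2 4] crossing[of 0 1 2 4] separate[of 0 1 2 4]
      nested[of 0 1 3 4] crossing[of 0 1 3 4] separate[of 0 1 3 4]
      nested[of 0 2 3 4] crossing[of 0 2 3 4] separate[of 0 2 3 4]
      nested[of 1 2 3 4] crossing[of 1 2 3 4] separate[of 1 2 3 4]
    by simp
  then show False by presburger
qed

section \<open>Graphs drawn without crossings of independent edges\<close>

text \<open>Only edges without a common endpoint are required to be drawn disjointly; this weak form of
  planarity is directly closed under contraction.\<close>

definition quasi_planar :: "'v set set \<Rightarrow> bool" where
  "quasi_planar E \<longleftrightarrow> (\<exists>(q :: 'v \<Rightarrow> complex) D.
     (\<forall>e\<in>E. path_connected (D e) \<and> q ` e \<subseteq> D e) \<and>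
     (\<forall>e\<in>E. \<forall>f\<in>E. e \<inter> f = {} \<longrightarrow> D e \<inter> D f = {}))"

lemma quasi_planarE:
  fixes E :: "'v set set"
  assumes "quasi_planar E"
  obtains q :: "'v \<Rightarrow> complex" and D where
    "\<And>e. e \<in> E \<Longrightarrow> path_connected (D e) \<and> q ` e \<subseteq> D e"
    "\<And>e f. e \<in> E \<Longrightarrow> f \<in> E \<Longrightarrow> e \<inter> f = {} \<Longrightarrow> D e \<inter> D f = {}"
proof -
  from assms obtain q :: "'v \<Rightarrow> complex" and D where
    "(\<forall>e\<in>E. path_connected (D e) \<and> q ` e \<subseteq> D e) \<and>
     (\<forall>e\<in>E. \<forall>f\<in>E. e \<inter> f = {} \<longrightarrow> D e \<inter> D f = {})"
    unfolding quasi_planar_def by (elim exE) (rule that)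
  then show ?thesis by (intro that[of D q]) simp_all
qed

lemma quasi_planar_subset: "quasi_planar E \<Longrightarrow> F \<subseteq> E \<Longrightarrow> quasi_planar F"
  unfolding quasi_planar_def by (erule ex_forward)+ (simp add: subset_iff)

text \<open>\<open>u\<close> keeps its point, and a new edge \<open>{u, x}\<close> runs along the
  drawings of \<open>{u, v}\<close> and \<open>{v, x}\<close>, which meet in \<open>q v\<close>. An
  old edge that misses \<open>u\<close>, \<open>v\<close> and \<open>x\<close> is disjoint from
  both.\<close>

lemma quasi_planar_contract:
  assumes "quasi_planar E" "{u, v} \<in> E"
  shows "quasi_planar ({e\<in>E. v \<notin> e} \<union> {{u, x} |x. {v, x} \<in> E \<and> x \<noteq> u \<and> x \<noteq> v})"
proof -
  obtain q :: "'a \<Rightarrow> complex" and D where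
    D: "\<And>e. e \<in> E \<Longrightarrow> path_connected (D e) \<and> q ` e \<subseteq> D e" and
    disj: "\<And>e f. e \<in> E \<Longrightarrow> f \<in> E \<Longrightarrow> e \<inter> f = {} \<Longrightarrow> D e \<inter> D f = {}"
    by (rule quasi_planarE[OF assms(1)]) (rule that; assumption)
  let ?A = "{e\<in>E. v \<notin> e}" and ?B = "{{u, x} |x. {v, x} \<in> E \<and> x \<noteq> u \<and> x \<noteq> v}"
  \<comment> \<open>For a new edge \<open>e = {u, x}\<close> the set
    \<open>insert v (e - {u})\<close> recovers \<open>{v, x}\<close>.\<close>
  define D' where "D' = (\<lambda>e. if e \<in> ?A then D e else D {u, v} \<union> D (insert v (e - {u})))"
  have B: "D' e = D {u, v} \<union> D {v, x}" if "e \<notin> ?A" "e = {u, x}" "x \<noteq> u" for e x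
    using that by (auto simp: D'_def insert_commute intro!: arg_cong[of _ _ D])
  have "path_connected (D' e) \<and> q ` e \<subseteq> D' e" if e: "e \<in> ?A \<union> ?B" for e
  proof (cases "e \<in> ?A")
    case True
    then show ?thesis using D by (simp add: D'_def)
  next
    case False
    with e obtain x where x: "e = {u, x}" "{v, x} \<in> E" "x \<noteq> u" by blast
    have "q v \<in> D {u, v} \<inter> D {v, x}" using D[OF x(2)] D[OF assms(2)] by auto
    then have "path_connected (D {u, v} \<union> D {v, x})"
      using D x(2) assms(2) by (intro path_connected_Un) auto
    then show ?thesis
      using B[OF False x(1,3)] x(1) D[OF x(2)] D[OF assms(2)] by auto
  qed
  moreover have half: "D' e \<inter> D' f = {}" if e: "e \<in> ?A \<union> ?B" and f: "f \<in> ?A" and "e \<inter> f = {}" for e f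
  proof (cases "e \<in> ?A")
    case True
    then show ?thesis using that disj[of e f] by (simp add: D'_def)
  next
    case False
    with e obtain x where x: "e = {u, x}" "{v, x} \<in> E" "x \<noteq> u" by blast
    have "D {u, v} \<inter> D f = {}" "D {v, x} \<inter> D f = {}"
      using that x(1) by (intro disj assms(2) x(2); auto)+
    then show ?thesis
      using B[OF False x(1,3)] f by (auto simp: D'_def)
  qed
  \<comment> \<open>Two new edges share \<open>u\<close>, so of two disjoint edges at least one is
    old.\<close>
  have "D' e \<inter> D' f = {}" if "e \<in> ?A \<union> ?B" "f \<in> ?A \<union> ?B" "e \<inter> f = {}" for e f
  proof (cases "f \<in> ?A")
    case True
    then show ?thesis using half that by blast
  next
    case False
    then have "e \<in> ?A" using that by blast
    then show ?thesis using half[of f e] that by blast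
  qed
  ultimately show ?thesis
    unfolding quasi_planar_def by (intro exI[of _ q] exI[of _ D'] conjI ballI impI) simp_all
qed

lemma K5_not_quasi_planar:
  assumes "quasi_planar E" "card A = 5" and K: "\<And>x y. x \<in> A \<Longrightarrow> y \<in> A \<Longrightarrow> x \<noteq> y \<Longrightarrow> {x, y} \<in> E"
  shows False
proof -
  obtain q :: "'a \<Rightarrow> complex" and D where
    D: "\<And>e. e \<in> E \<Longrightarrow> path_connected (D e) \<and> q ` e \<subseteq> D e" and
    disj: "\<And>e f. e \<in> E \<Longrightarrow> f \<in> E \<Longrightarrow> e \<inter> f = {} \<Longrightarrow> D e \<inter> D f = {}"
    by (rule quasi_planarE[OF assms(1)]) (rule that; assumption)
  have "finite A" using assms(2) by (simp add: card_ge_0_finite)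
  then obtain h where "bij_betw h {0..<5::nat} A"
    using ex_bij_betw_nat_finite[of A] assms(2) by auto
  then have inj: "h i = h j \<longleftrightarrow> i = j" and hA: "h i \<in> A" if "i < 5" "j < 5" for i j
    using that by (auto simp: bij_betw_def inj_on_def)
  have hE: "{h i, h j} \<in> E" if "i < j" "j < 5" for i j
    using that by (intro K) (auto simp: inj intro!: hA)
  show False
  proof (rule K5_drawing_impossible[of "\<lambda>i j. D {h i, h j}" "\<lambda>i. q (h i)"])
    show "path_connected (D {h i, h j}) \<and> q (h i) \<in> D {h i, h j} \<and> q (h j) \<in> D {h i, h j}"
      if "i < j" "j < 5" for i j
      using D[OF hE[OF that]] by auto
    show "D {h i, h j} \<inter> D {h k, h l} = {}"
      if "i < j" "k < l" "j < 5" "l < 5" "{i, j} \<inter> {k, l} = {}" for i j k l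
      using that by (intro disj hE) (auto simp: inj)
  qed
qed

lemma card_neighbours:
  assumes "\<And>e. e \<in> E \<Longrightarrow> card e = 2"
  shows "card {x. {v, x} \<in> E} = card {e \<in> E. v \<in> e}"
proof (rule bij_betw_same_card[of "\<lambda>x. {v, x}"])
  have "\<exists>x. e = {v, x}" if "e \<in> E" "v \<in> e" for e
    using assms[OF that(1)] that(2) by (auto simp: card_2_iff)
  then show "bij_betw (\<lambda>x. {v, x}) {x. {v, x} \<in> E} {e \<in> E. v \<in> e}"
    by (auto simp: bij_betw_def inj_on_def doubleton_eq_iff)
qed

text \<open>Mader's argument for graphs without a \<open>K\<^sub>5\<close> minor: in a minimal counterexample some vertex
  \<open>v\<close> has degree at most 5, and every edge at \<open>v\<close> lies in at least three triangles, so \<open>v\<close> and its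
  neighbours contain \<open>K\<^sub>5\<close>, possibly after contracting one edge.\<close>

lemma quasi_planar_card_edges:
  assumes "quasi_planar E" "finite V" "V \<noteq> {}" and "\<And>e. e \<in> E \<Longrightarrow> e \<subseteq> V \<and> card e = 2"
  shows "card E + 2 \<le> 3 * card V"
  using assms
proof (induction "card V" arbitrary: V E rule: less_induct)
  case less
  show ?case
  proof (rule ccontr)
    assume "\<not> card E + 2 \<le> 3 * card V"
    then have "3 * card V - 1 \<le> card E" by simp
    \<comment> \<open>Exactly one edge more than the bound allows is kept, so the degree sum is
      \<open>6 * card V - 2\<close>, below six per vertex.\<close>
    then obtain F where F: "F \<subseteq> E" "card F = 3 * card V - 1" "finite F"
      by (rule obtain_subset_with_card_n)
    have V0: "card V > 0" using less.prems by (simp add: card_gt_0_iff)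
    have qF: "quasi_planar F" using less.prems(1) F(1) by (rule quasi_planar_subset)
    have eF: "e \<subseteq> V" "card e = 2" if "e \<in> F" for e
      using less.prems(4) F(1) that by auto
    have neq: "x \<noteq> y" if "{x, y} \<in> F" for x y
      using eF(2)[OF that] by auto
    have single: "{x} \<notin> F" for x
      using eF(2)[of "{x}"] by auto
    have inV: "x \<in> V" "y \<in> V" if "{x, y} \<in> F" for x y
      using eF(1)[OF that] by auto
    have sym: "{x, y} \<in> F \<longleftrightarrow> {y, x} \<in> F" for x y
      by (simp add: insert_commute)
    have V1: "card V \<noteq> 1"
    proof
      assume "card V = 1"
      then obtain x where "V = {x}" by (auto simp: card_1_singleton_iff)
      have "F = {}"
      proof (rule ccontr)
        assume "F \<noteq> {}"
        then obtain e where "e \<in> F" by blast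
        then show False using eF[of e] \<open>V = {x}\<close> card_mono[of V e] by simp
      qed
      then show False using F(2) \<open>card V = 1\<close> by simp
    qed
    let ?N = "\<lambda>v. {x. {v, x} \<in> F}"
    have deg: "card (?N v) = card {e \<in> F. v \<in> e}" for v
      using eF by (intro card_neighbours) auto
    have "(\<Sum>v\<in>V. card (?N v)) = (\<Sum>e\<in>F. 2)"
      unfolding deg
    proof (rule sum_multicount_gen)
      show "\<forall>e\<in>F. card {v \<in> V. v \<in> e} = 2"
        using eF by (auto simp: Int_absorb1 Collect_mem_eq Int_def[symmetric])
    qed (use less.prems F in auto)
    then have sumdeg: "(\<Sum>v\<in>V. card (?N v)) = 2 * (3 * card V - 1)"
      using F(2) by simp
    have "\<exists>v\<in>V. card (?N v) \<le> 5"
    proof (rule ccontr)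
      assume "\<not> ?thesis"
      then have "(\<Sum>v\<in>V. 6) \<le> (\<Sum>v\<in>V. card (?N v))"
        by (intro sum_mono) auto
      then show False using sumdeg V0 by simp
    qed
    then obtain v where v: "v \<in> V" "card (?N v) \<le> 5" by blast
    have cV: "card (V - {v}) = card V - 1" "card (V - {v}) < card V" "V - {v} \<noteq> {}"
    proof -
      show 1: "card (V - {v}) = card V - 1" using v(1) less.prems(2) by simp
      then show "card (V - {v}) < card V" using V0 by simp
      have "card (V - {v}) \<noteq> 0" using 1 V0 V1 by simp
      then show "V - {v} \<noteq> {}" by (metis card.empty)
    qed
    have finN: "finite (?N x)" for x
      using inV less.prems(2) by (intro finite_subset[of "?N x" V]) auto
    let ?A = "{e\<in>F. v \<notin> e}"
    have "card F = card ?A + card (?N v)"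
      unfolding deg using F(3) by (subst card_Un_disjoint[symmetric]) (auto intro: arg_cong[of _ _ card])
    then have cA: "card ?A = 3 * card V - 1 - card (?N v)" using F(2) by simp
    \<comment> \<open>Deleting \<open>v\<close> must leave at most \<open>3 * card V - 5\<close>
      edges, so at least four are lost.\<close>
    have "card ?A + 2 \<le> 3 * card (V - {v})"
      by (rule less.hyps) (use cV less.prems(2) eF quasi_planar_subset[OF qF] in auto)
    then have deg4: "card (?N v) \<ge> 4" using cA cV V0 V1 by simp
    \<comment> \<open>Contracting \<open>{u, v}\<close> must also lose at least four edges. It loses
      that edge itself and one edge for each common neighbour of \<open>u\<close> and
      \<open>v\<close>.\<close>
    have common: "card {x \<in> ?N v. {u, x} \<in> F} \<ge> 3" if u: "u \<in> ?N v" for u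
    proof -
      have uv: "{u, v} \<in> F" using u sym by simp
      let ?B = "{{u, x} |x. {v, x} \<in> F \<and> x \<noteq> u \<and> x \<noteq> v}"
      let ?M = "{x \<in> ?N v. x \<noteq> u \<and> {u, x} \<notin> F}"
      have AB: "?A \<union> ?B = ?A \<union> (\<lambda>x. {u, x}) ` ?M"
        using neq uv by (auto simp: doubleton_eq_iff)
      have "card ((\<lambda>x. {u, x}) ` ?M) = card ?M"
        by (rule card_image) (auto simp: inj_on_def doubleton_eq_iff)
      then have "card (?A \<union> ?B) = card ?A + card ?M"
        unfolding AB using F(3) finN by (subst card_Un_disjoint) auto
      moreover have "card (?A \<union> ?B) + 2 \<le> 3 * card (V - {v})"
      proof (rule less.hyps)
        show "e \<subseteq> V - {v} \<and> card e = 2" if "e \<in> ?A \<union> ?B" for e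
          using that eF inV neq[OF uv] inV[OF uv] by (auto simp: card_2_iff)
      qed (use cV less.prems(2) quasi_planar_contract[OF qF uv] in auto)
      moreover have "card (?N v) = card ({x \<in> ?N v. {u, x} \<in> F} \<union> {u} \<union> ?M)"
        using u by (intro arg_cong[of _ _ card]) auto
      then have "card (?N v) = card {x \<in> ?N v. {u, x} \<in> F} + 1 + card ?M"
        using finN single[of u] by (subst (asm) card_Un_disjoint, simp, simp, force)
          (subst (asm) card_Un_disjoint, auto)
      ultimately show ?thesis using cA cV V0 V1 v(2) by simp
    qed
    have vN: "{v, x} \<in> F" "{x, v} \<in> F" "x \<noteq> v" if "x \<in> ?N v" for x
      using that neq sym by auto
    show False
    proof (cases "card (?N v) = 4")
      case True
      show False
      proof (rule K5_not_quasi_planar[OF qF])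
        show "card (insert v (?N v)) = 5" using True finN single by (subst card_insert_disjoint) auto
        have full: "{x, y} \<in> F" if "x \<in> ?N v" "y \<in> ?N v" "x \<noteq> y" for x y
        proof -
          \<comment> \<open>Only three other neighbours of \<open>v\<close> exist, so the three
            triangles at \<open>{v, x}\<close> use them all.\<close>
          have "{z \<in> ?N v. {x, z} \<in> F} \<subseteq> ?N v - {x}" using single by auto
          moreover have "card (?N v - {x}) = 3" using that(1) True finN by simp
          ultimately have "{z \<in> ?N v. {x, z} \<in> F} = ?N v - {x}"
            using common[OF that(1)] finN by (intro card_seteq) auto
          then show ?thesis using that by blast
        qed
        show "{x, y} \<in> F" if "x \<in> insert v (?N v)" "y \<in> insert v (?N v)" "x \<noteq> y" for x y
          using that full vN by blast
      qed
    next
      case False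
      then have deg5: "card (?N v) = 5" using deg4 v(2) by simp
      \<comment> \<open>Of the four other neighbours of \<open>v\<close>, at least three are
        adjacent to \<open>x\<close>: the non-edges inside the neighbourhood form a
        matching.\<close>
      have one: "y = z" if "x \<in> ?N v" "y \<in> ?N v" "z \<in> ?N v" "x \<noteq> y" "x \<noteq> z" "{x, y} \<notin> F" "{x, z} \<notin> F"
        for x y z
      proof (rule ccontr)
        assume "y \<noteq> z"
        have "{w \<in> ?N v. {x, w} \<in> F} \<subseteq> ?N v - {x, y, z}" using that single by auto
        then have "card {w \<in> ?N v. {x, w} \<in> F} \<le> card (?N v - {x, y, z})"
          using finN by (intro card_mono) auto
        also have "\<dots> = 2" using deg5 that \<open>y \<noteq> z\<close> finN by (subst card_Diff_subset) auto
        finally show False using common[OF that(1)] by simp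
      qed
      show False
      proof (cases "\<forall>x\<in>?N v. \<forall>y\<in>?N v. x \<noteq> y \<longrightarrow> {x, y} \<in> F")
        case True
        then show False using K5_not_quasi_planar[OF qF deg5] by blast
      next
        case False
        then obtain a c where ac: "a \<in> ?N v" "c \<in> ?N v" "a \<noteq> c" "{a, c} \<notin> F" by blast
        have "card (?N v - {a, c}) = 3" using deg5 ac finN by (subst card_Diff_subset) auto
        then obtain x y z where xyz: "?N v - {a, c} = {x, y, z}" "x \<noteq> y" "y \<noteq> z" "x \<noteq> z"
          by (auto simp: card_3_iff)
        then have N: "?N v = {a, c, x, y, z}" using ac by blast
        \<comment> \<open>\<open>b\<close> will be contracted away while \<open>h\<close> and
          \<open>d\<close> stay, so \<open>{h, d}\<close> has to be an edge; at most one of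
          \<open>{x, y}\<close> and \<open>{x, z}\<close> is missing.\<close>
        have "\<exists>h b d. {h, b, d} = {x, y, z} \<and> h \<noteq> b \<and> h \<noteq> d \<and> b \<noteq> d \<and> {h, d} \<in> F"
        proof (cases "{x, y} \<in> F")
          case True
          then show ?thesis using xyz(2-4) by (intro exI[of _ x] exI[of _ z] exI[of _ y]) auto
        next
          case False
          have "x \<in> ?N v" "y \<in> ?N v" "z \<in> ?N v" unfolding N by simp_all
          from one[OF this xyz(2,4) False] have "{x, z} \<in> F" using xyz(3) by blast
          then show ?thesis using xyz(2-4) by (intro exI[of _ x] exI[of _ y] exI[of _ z]) auto
        qed
        then obtain h b d where hbd: "{h, b, d} = {x, y, z}" "h \<noteq> b" "h \<noteq> d" "b \<noteq> d" "{h, d} \<in> F"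
          by blast
        have "?N v = {a, c} \<union> {h, b, d}" unfolding N hbd(1) by blast
        then have N': "?N v = {a, c, h, b, d}" by (simp only: Un_insert_left Un_empty_left)
        have out: "w \<noteq> a" "w \<noteq> c" if "w \<in> {h, b, d}" for w
          using that unfolding hbd(1) xyz(1)[symmetric] by blast+
        \<comment> \<open>Inside the neighbourhood, \<open>a\<close> and \<open>c\<close> miss only
          each other.\<close>
        have "{a, w} \<in> F \<and> {c, w} \<in> F" if w: "w \<in> {h, b, d}" for w
        proof -
          have "w \<in> ?N v" unfolding N' using w by simp
          moreover have "{c, a} \<notin> F" using ac(4) sym by simp
          ultimately show ?thesis
            using one[OF ac(1,2) _ ac(3), of w] one[OF ac(2,1), of w] out[OF w] ac by metis
        qed
        then have ed: "{a, b} \<in> F" "{b, c} \<in> F" "{a, h} \<in> F" "{a, d} \<in> F" "{c, h} \<in> F" "{c, d} \<in> F"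
          using sym by auto
        \<comment> \<open>Contracting \<open>b\<close> into \<open>a\<close> turns
          \<open>{b, c}\<close> into the missing edge \<open>{a, c}\<close> and completes a
          \<open>K5\<close> on \<open>v, h, a, c, d\<close>.\<close>
        define E' where "E' = {e\<in>F. b \<notin> e} \<union> {{a, x} |x. {b, x} \<in> F \<and> x \<noteq> a \<and> x \<noteq> b}"
        have dist: "v \<notin> {a, c, h, b, d}" using N' single[of v] by (metis insert_absorb2 mem_Collect_eq)
        have o: "h \<noteq> a" "h \<noteq> c" "b \<noteq> a" "b \<noteq> c" "d \<noteq> a" "d \<noteq> c"
          using out[of h] out[of b] out[of d] by simp_all
        have "b \<noteq> v" using dist by blast
        have "{v, w} \<in> F" if "w \<in> {h, a, c, d}" for w
        proof -
          have "w \<in> ?N v" unfolding N' using that by blast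
          then show ?thesis by simp
        qed
        with \<open>b \<noteq> v\<close> have E': "{v, h} \<in> E'" "{v, a} \<in> E'" "{v, c} \<in> E'" "{v, d} \<in> E'"
          "{a, h} \<in> E'" "{a, d} \<in> E'" "{c, h} \<in> E'" "{c, d} \<in> E'" "{h, d} \<in> E'"
          using ed hbd(2-5) o dist by (simp_all add: E'_def)
        have "{a, c} \<in> E'" using ed(2) ac(3) o(4) unfolding E'_def by blast
        with E' have "{s, t} \<in> E'" if "s \<in> {v, h, a, c, d}" "t \<in> {v, h, a, c, d}" "s \<noteq> t" for s t
          using that by (elim insertE emptyE) (simp_all add: insert_commute)
        moreover have "quasi_planar E'"
          unfolding E'_def by (rule quasi_planar_contract[OF qF ed(1)])
        moreover have "card {v, h, a, c, d} = 5"
          using dist o hbd(2-4) ac(3) by simp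
        ultimately show False using K5_not_quasi_planar by blast
      qed
    qed
  qed
qed

section \<open>Orientations and random sampling\<close>

text \<open>If both choices of an endpoint for the edge \<open>e = {u, v}\<close> were blocked by tight sets
  \<open>A \<ni> u\<close> and \<open>B \<ni> v\<close>, then by submodularity \<open>A \<union> B\<close> would violate the counting hypothesis.\<close>

lemma orientation_exists:
  fixes c :: "'v \<Rightarrow> nat"
  assumes "finite E" "finite V" "\<And>e. e \<in> E \<Longrightarrow> e \<subseteq> V \<and> card e = 2"
    and "\<And>S. S \<subseteq> V \<Longrightarrow> card {e \<in> E. e \<subseteq> S} \<le> sum c S"
  shows "\<exists>h. (\<forall>e\<in>E. h e \<in> e) \<and> (\<forall>v\<in>V. card {e \<in> E. h e = v} \<le> c v)"
  using assms(1,3,4)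
proof (induction E arbitrary: c rule: finite_induct)
  case empty
  then show ?case by simp
next
  case (insert e E)
  let ?n = "\<lambda>S. card {f \<in> E. f \<subseteq> S}"
  obtain u v where uv: "e = {u, v}" "u \<in> V" "v \<in> V"
    using insert.prems(1)[of e] by (auto simp: card_2_iff)
  have fin: "finite {f \<in> E. f \<subseteq> S}" for S
    using insert.hyps by simp
  have finS: "finite S" if "S \<subseteq> V" for S
    using assms(2) that by (rule rev_finite_subset)
  have card_insert: "card {f \<in> insert e E. f \<subseteq> S} = (if e \<subseteq> S then Suc (?n S) else ?n S)" for S
  proof -
    have "{f \<in> insert e E. f \<subseteq> S} = (if e \<subseteq> S then insert e {f \<in> E. f \<subseteq> S} else {f \<in> E. f \<subseteq> S})"
      by auto
    then show ?thesis using insert.hyps fin by simp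
  qed
  have slack: "?n S \<le> sum c S" "e \<subseteq> S \<Longrightarrow> ?n S < sum c S" if "S \<subseteq> V" for S
    using insert.prems(2)[OF that] unfolding card_insert by (auto split: if_splits)
  have "\<exists>w\<in>e. \<forall>S. S \<subseteq> V \<and> w \<in> S \<longrightarrow> ?n S < sum c S"
  proof (rule ccontr)
    assume "\<not> ?thesis"
    then obtain A B where A: "A \<subseteq> V" "u \<in> A" "sum c A \<le> ?n A" and B: "B \<subseteq> V" "v \<in> B" "sum c B \<le> ?n B"
      using uv(1) by (auto simp: not_less)
    have "?n A + ?n B = card ({f \<in> E. f \<subseteq> A} \<union> {f \<in> E. f \<subseteq> B}) + card ({f \<in> E. f \<subseteq> A} \<inter> {f \<in> E. f \<subseteq> B})"
      by (rule card_Un_Int[OF fin fin])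
    also have "\<dots> \<le> ?n (A \<union> B) + ?n (A \<inter> B)"
      by (intro add_mono card_mono fin) auto
    \<comment> \<open>The inequality is strict because \<open>e\<close>, which is not counted in
      \<open>E\<close>, lies inside \<open>A \<union> B\<close>.\<close>
    also have "\<dots> < sum c (A \<union> B) + sum c (A \<inter> B)"
      using A B uv(1) by (intro add_less_le_mono slack) auto
    also have "\<dots> = sum c A + sum c B"
      using sum.union_inter[OF finS[OF A(1)] finS[OF B(1)], of c] by simp
    finally show False using A(3) B(3) by simp
  qed
  then obtain w where w: "w \<in> e" "\<And>S. S \<subseteq> V \<Longrightarrow> w \<in> S \<Longrightarrow> ?n S < sum c S" by blast
  have wV: "w \<in> V" using w(1) uv by auto
  have cw: "c w > 0" using w(2)[of "{w}"] wV by simp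
  \<comment> \<open>The edge \<open>e\<close> is charged to \<open>w\<close>; the slack of every set
    containing \<open>w\<close> preserves the counting hypothesis.\<close>
  define c' where "c' = c(w := c w - 1)"
  have "?n S \<le> sum c' S" if "S \<subseteq> V" for S
  proof (cases "w \<in> S")
    case True
    then have "sum c S = Suc (sum c' S)"
      using cw by (simp add: sum.remove[OF finS[OF that] True] c'_def)
    then show ?thesis using w(2)[OF that True] by simp
  next
    case False
    then have "sum c' S = sum c S" by (intro sum.cong) (auto simp: c'_def)
    then show ?thesis using slack(1)[OF that] by simp
  qed
  then have "\<exists>h. (\<forall>f\<in>E. h f \<in> f) \<and> (\<forall>x\<in>V. card {f \<in> E. h f = x} \<le> c' x)"
    by (intro insert.IH insert.prems(1)) simp_all
  then obtain h where h: "\<forall>f\<in>E. h f \<in> f" "\<forall>x\<in>V. card {f \<in> E. h f = x} \<le> c' x"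
    by blast
  have "card {f \<in> insert e E. (h(e := w)) f = x} \<le> c x" if "x \<in> V" for x
  proof -
    have "{f \<in> insert e E. (h(e := w)) f = x} =
        (if x = w then insert e {f \<in> E. h f = x} else {f \<in> E. h f = x})"
      using insert.hyps by auto
    then show ?thesis
      using bspec[OF h(2) that] cw insert.hyps by (auto simp: c'_def split: if_splits)
  qed
  moreover have "\<forall>f\<in>insert e E. (h(e := w)) f \<in> f"
    using h(1) w(1) by simp
  ultimately show ?case by blast
qed

text \<open>This is the probability that a random subset contains \<open>A\<close> and avoids
  \<open>K\<close>. Expand the product of \<open>f x + g x\<close>: \<open>f\<close> vanishes on
  \<open>K\<close> and \<open>g\<close> on \<open>A\<close>, which removes all other subsets, and
  vertices outside both contribute the factor \<open>p + (1 - p) = 1\<close>.\<close>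

lemma sum_random_subset:
  fixes p :: real
  assumes "finite V" "A \<subseteq> V" "K \<subseteq> V" "A \<inter> K = {}"
  shows "(\<Sum>X | X \<subseteq> V \<and> A \<subseteq> X \<and> X \<inter> K = {}. p ^ card X * (1 - p) ^ card (V - X))
    = p ^ card A * (1 - p) ^ card K"
proof -
  have fin: "finite A" "finite K" "\<And>X. X \<subseteq> V \<Longrightarrow> finite X"
    using assms by (auto intro: finite_subset)
  define f g where "f = (\<lambda>x. if x \<in> K then 0 else p)" and "g = (\<lambda>x. if x \<in> A then 0 else 1 - p)"
  have "(\<Sum>X\<in>Pow V. prod f X * prod g (V - X)) =
      (\<Sum>X | X \<subseteq> V \<and> A \<subseteq> X \<and> X \<inter> K = {}. p ^ card X * (1 - p) ^ card (V - X))"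
  proof (rule sum.mono_neutral_cong_right)
    show "\<forall>X\<in>Pow V - {X. X \<subseteq> V \<and> A \<subseteq> X \<and> X \<inter> K = {}}. prod f X * prod g (V - X) = 0"
    proof
      fix X assume X: "X \<in> Pow V - {X. X \<subseteq> V \<and> A \<subseteq> X \<and> X \<inter> K = {}}"
      then consider x where "x \<in> X" "x \<in> K" | x where "x \<in> V - X" "x \<in> A"
        using assms(2) by blast
      then show "prod f X * prod g (V - X) = 0"
      proof cases
        case 1
        then have "prod f X = 0" using X fin by (intro prod_zero) (auto simp: f_def)
        then show ?thesis by simp
      next
        case 2
        then have "prod g (V - X) = 0" using assms(1) by (intro prod_zero) (auto simp: g_def)
        then show ?thesis by simp
      qed
    qed
    show "prod f X * prod g (V - X) = p ^ card X * (1 - p) ^ card (V - X)"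
      if "X \<in> {X. X \<subseteq> V \<and> A \<subseteq> X \<and> X \<inter> K = {}}" for X
    proof -
      have "prod f X = (\<Prod>x\<in>X. p)"
        using that by (intro prod.cong) (auto simp: f_def)
      moreover have "prod g (V - X) = (\<Prod>x\<in>V - X. 1 - p)"
        using that by (intro prod.cong) (auto simp: g_def)
      ultimately show ?thesis by simp
    qed
  qed (use assms(1) in auto)
  moreover have "(\<Sum>X\<in>Pow V. prod f X * prod g (V - X)) = (\<Prod>x\<in>V. f x + g x)"
    by (rule prod_add[OF assms(1), symmetric])
  moreover have "(\<Prod>x\<in>V. f x + g x) = (\<Prod>x\<in>A \<union> K. f x + g x)"
    using assms by (intro prod.mono_neutral_right) (auto simp: f_def g_def)
  moreover have "\<dots> = (\<Prod>x\<in>A. f x + g x) * (\<Prod>x\<in>K. f x + g x)"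
    using fin assms(4) by (intro prod.union_disjoint)
  moreover have "(\<Prod>x\<in>A. f x + g x) = (\<Prod>x\<in>A. p)"
    using assms(4) by (intro prod.cong) (auto simp: f_def g_def)
  moreover have "(\<Prod>x\<in>K. f x + g x) = (\<Prod>x\<in>K. 1 - p)"
    using assms(4) by (intro prod.cong) (auto simp: f_def g_def)
  ultimately show ?thesis by simp
qed

text \<open>With each vertex kept with probability \<open>p = 1 / (m + 1)\<close>, an edge survives with probability
  at least \<open>p\<^sup>2 (1 - p) ^ m \<ge> p\<^sup>2 / e\<close>, while the expected number of survivors is at most \<open>3 p |V|\<close>.\<close>

lemma card_edges_by_sampling:
  fixes V :: "'v set" and K :: "'v set \<Rightarrow> 'v set"
  assumes "finite V" "\<And>e. e \<in> E \<Longrightarrow> e \<subseteq> V \<and> card e = 2"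
    and K: "\<And>e. e \<in> E \<Longrightarrow> K e \<subseteq> V - e \<and> card (K e) \<le> m"
    and sparse: "\<And>X. X \<subseteq> V \<Longrightarrow> card {e \<in> E. e \<subseteq> X \<and> X \<inter> K e = {}} \<le> 3 * card X"
  shows "real (card E) \<le> 3 * exp 1 * (real m + 1) * real (card V)"
proof -
  define p where "p = 1 / (real m + 1)"
  have p: "0 < p" "p \<le> 1" by (simp_all add: p_def)
  have finE: "finite E"
    using assms(1,2) by (intro finite_subset[of E "Pow V"]) auto
  define W where "W = (\<lambda>X. p ^ card X * (1 - p) ^ card (V - X))"
  have W: "W X \<ge> 0" for X using p by (simp add: W_def)
  \<comment> \<open>For \<open>m > 0\<close>, \<open>1 / (1 - p) = 1 + 1 / m\<close> is at most
    \<open>exp (1 / m)\<close>; for \<open>m = 0\<close> the power is 1.\<close>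
  have expm: "(1 - p) ^ m \<ge> exp (- 1)"
  proof (cases "m = 0")
    case False
    have "1 / (1 - p) = 1 + 1 / real m"
      using False by (simp add: p_def field_simps)
    then have "(1 / (1 - p)) ^ m \<le> exp (1 / real m) ^ m"
      using p by (intro power_mono) (auto intro: exp_ge_add_one_self)
    also have "\<dots> = exp 1" using False by (simp flip: exp_of_nat_mult)
    finally have "1 / (1 - p) ^ m \<le> exp 1" by (simp add: power_one_over)
    moreover have "p < 1" using False by (simp add: p_def)
    ultimately show ?thesis by (simp add: exp_minus field_simps)
  qed simp
  \<comment> \<open>Double counting of the pairs of an edge \<open>e\<close> and a sample
    \<open>X\<close> in which \<open>e\<close> survives, weighted by the probability
    \<open>W X\<close> of drawing \<open>X\<close>.\<close>
  have "real (card E) * (p\<^sup>2 * exp (- 1)) = (\<Sum>e\<in>E. p\<^sup>2 * exp (- 1))" by simp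
  also have "\<dots> \<le> (\<Sum>e\<in>E. \<Sum>X | X \<subseteq> V \<and> e \<subseteq> X \<and> X \<inter> K e = {}. W X)"
  proof (rule sum_mono)
    fix e assume e: "e \<in> E"
    have "exp (- 1) \<le> (1 - p) ^ card (K e)"
      using expm K[OF e] p power_decreasing[of "card (K e)" m "1 - p"] by simp
    then have "p\<^sup>2 * exp (- 1) \<le> p ^ card e * (1 - p) ^ card (K e)"
      using assms(2)[OF e] by (simp add: mult_left_mono)
    also have "\<dots> = (\<Sum>X | X \<subseteq> V \<and> e \<subseteq> X \<and> X \<inter> K e = {}. W X)"
      unfolding W_def using assms(1,2) K e by (intro sum_random_subset[symmetric]) auto
    finally show "p\<^sup>2 * exp (- 1) \<le> (\<Sum>X | X \<subseteq> V \<and> e \<subseteq> X \<and> X \<inter> K e = {}. W X)" .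
  qed
  also have "\<dots> = (\<Sum>e\<in>E. \<Sum>X | X \<in> Pow V \<and> (e \<subseteq> X \<and> X \<inter> K e = {}). W X)" by simp
  also have "\<dots> = (\<Sum>X\<in>Pow V. \<Sum>e | e \<in> E \<and> (e \<subseteq> X \<and> X \<inter> K e = {}). W X)"
    using finE assms(1) by (intro sum.swap_restrict) auto
  also have "\<dots> = (\<Sum>X\<in>Pow V. W X * real (card {e \<in> E. e \<subseteq> X \<and> X \<inter> K e = {}}))"
    by (simp add: mult.commute)
  also have "\<dots> \<le> (\<Sum>X\<in>Pow V. W X * (3 * real (card X)))"
  proof (intro sum_mono mult_left_mono W)
    fix X assume "X \<in> Pow V"
    then show "real (card {e \<in> E. e \<subseteq> X \<and> X \<inter> K e = {}}) \<le> 3 * real (card X)"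
      using sparse[of X] by simp
  qed
  \<comment> \<open>Writing \<open>card X\<close> as a sum over its vertices and swapping sums
    leaves the probability \<open>p\<close> that a given vertex is chosen.\<close>
  also have "\<dots> = (\<Sum>X\<in>Pow V. 3 * (\<Sum>x | x \<in> V \<and> x \<in> X. W X))"
  proof (rule sum.cong)
    fix X assume "X \<in> Pow V"
    then have "{x. x \<in> V \<and> x \<in> X} = X" by auto
    then show "W X * (3 * real (card X)) = 3 * (\<Sum>x | x \<in> V \<and> x \<in> X. W X)" by simp
  qed simp
  also have "\<dots> = 3 * (\<Sum>X\<in>Pow V. \<Sum>x | x \<in> V \<and> x \<in> X. W X)"
    by (rule sum_distrib_left[symmetric])
  also have "(\<Sum>X\<in>Pow V. \<Sum>x | x \<in> V \<and> x \<in> X. W X) = (\<Sum>x\<in>V. \<Sum>X | X \<in> Pow V \<and> x \<in> X. W X)"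
    using assms(1) by (intro sum.swap_restrict) auto
  also have "\<dots> = (\<Sum>x\<in>V. p)"
  proof (rule sum.cong)
    fix x assume "x \<in> V"
    then show "(\<Sum>X | X \<in> Pow V \<and> x \<in> X. W X) = p"
      unfolding W_def using sum_random_subset[OF assms(1), of "{x}" "{}" p] by simp
  qed simp
  finally have "real (card E) * (p\<^sup>2 * exp (- 1)) \<le> 3 * (real (card V) * p)" by simp
  then have "p * (real (card E) * p * exp (- 1)) \<le> p * (3 * real (card V))"
    by (simp add: power2_eq_square mult_ac)
  then have "real (card E) * p * exp (- 1) \<le> 3 * real (card V)"
    using p(1) by simp
  then have "real (card E) * p * exp (- 1) * ((real m + 1) * exp 1) \<le>
      3 * real (card V) * ((real m + 1) * exp 1)"
    by (rule mult_right_mono) simp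
  moreover have "real (card E) * p * exp (- 1) * ((real m + 1) * exp 1) = real (card E)"
    by (simp add: p_def exp_minus)
  ultimately have "real (card E) \<le> 3 * real (card V) * ((real m + 1) * exp 1)" by (simp only:)
  then show ?thesis by (simp only: mult_ac)
qed

section \<open>Shallow minors of string graphs\<close>

lemma path_connected_chain:
  assumes "p \<noteq> []" "successively (\<lambda>x y. A x \<inter> A y \<noteq> {}) p" "\<And>x. x \<in> set p \<Longrightarrow> path_connected (A x)"
  shows "path_connected (\<Union>x\<in>set p. A x)"
  using assms
proof (induction p rule: induct_list012)
  case (3 x y zs)
  have "path_connected (A x \<union> (\<Union>z\<in>set (y # zs). A z))"
  proof (rule path_connected_Un)
    show "path_connected (\<Union>z\<in>set (y # zs). A z)"
      using 3 by simp
    show "A x \<inter> (\<Union>z\<in>set (y # zs). A z) \<noteq> {}"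
      using 3(4) by auto
  qed (use 3 in simp)
  then show ?case by simp
qed auto

text \<open>The \<open>LEAST\<close> in radius and distance is attained, since distances to finitely
  many vertices are bounded and connectedness supplies walks. A walk lists its vertices, hence
  \<open>Suc r\<close>.\<close>

lemma walks_from_centre:
  assumes "finite (verts H)" "connected_graph H" "graph_radius H \<le> r"
  obtains c where "c \<in> verts H" "\<And>w. w \<in> verts H \<Longrightarrow> \<exists>p. walk_betw H c p w \<and> length p \<le> Suc r"
proof -
  obtain c0 where c0: "c0 \<in> verts H"
    using assms(2) by (auto simp: connected_graph_def)
  have "\<forall>w\<in>verts H. graph_dist H c0 w \<le> Max (graph_dist H c0 ` verts H)"
    using assms(1) by simp
  then have "\<exists>r. \<exists>c\<in>verts H. \<forall>w\<in>verts H. graph_dist H c w \<le> r"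
    using c0 by blast
  then have "\<exists>c\<in>verts H. \<forall>w\<in>verts H. graph_dist H c w \<le> graph_radius H"
    unfolding graph_radius_def by (rule LeastI_ex)
  then obtain c where c: "c \<in> verts H" "\<And>w. w \<in> verts H \<Longrightarrow> graph_dist H c w \<le> r"
    using assms(3) by (meson le_trans)
  have "\<exists>p. walk_betw H c p w \<and> length p \<le> Suc r" if w: "w \<in> verts H" for w
  proof -
    obtain p0 where p0: "walk_betw H c p0 w"
      using assms(2) c(1) w by (auto simp: connected_graph_def)
    then have "length p0 = Suc (length p0 - 1)"
      by (cases p0) (auto simp: walk_betw_def)
    with p0 have "\<exists>n p. walk_betw H c p w \<and> length p = Suc n" by blast
    then have "\<exists>p. walk_betw H c p w \<and> length p = Suc (graph_dist H c w)"
      unfolding graph_dist_def by (rule LeastI_ex)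
    then show ?thesis using c(2)[OF w] by auto
  qed
  with c(1) show ?thesis by (rule that)
qed

text \<open>Supplies the counting hypothesis of \<open>orientation_exists\<close> with constant
  capacity \<open>d\<close>, by applying the density bound to the subgraph induced by
  \<open>S\<close>.\<close>

lemma card_induced_edges_le:
  assumes "simple_graph G" "max_density G \<le> real d" "S \<subseteq> verts G"
  shows "card {e \<in> edges G. e \<subseteq> S} \<le> d * card S"
proof (cases "S = {}")
  case True
  then have "{e \<in> edges G. e \<subseteq> S} = {}"
    using assms(1) by (auto simp: simple_graph_def)
  then show ?thesis by (simp only: card.empty)
next
  case False
  have "finite S"
    using assms by (auto simp: simple_graph_def intro: finite_subset)
  have "subgraph (S, {e \<in> edges G. e \<subseteq> S}) G"
    using assms \<open>finite S\<close> by (auto simp: subgraph_def simple_graph_def)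
  then have "edge_density (S, {e \<in> edges G. e \<subseteq> S}) \<le> max_density G"
    unfolding max_density_def by (intro Max_ge max_density_wf[OF assms(1)]) blast
  then have "real (card {e \<in> edges G. e \<subseteq> S}) / real (card S) \<le> real d"
    using assms(2) unfolding edge_density_eq by simp
  then have "real (card {e \<in> edges G. e \<subseteq> S}) \<le> real (d * card S)"
    using False \<open>finite S\<close> by (simp add: divide_le_eq card_gt_0_iff)
  then show ?thesis by (simp only: of_nat_le_iff)
qed

lemma shallow_minor_edge_density_le:
  fixes G :: "'a ugraph" and J :: "'b ugraph"
  assumes "string_graph G" "max_density G \<le> real d" "shallow_minor r J G"
  shows "edge_density J \<le> 3 * exp 1 * ((2 * real r + 2) * real d + 1)"
proof -
  obtain \<gamma> :: "'a \<Rightarrow> real \<Rightarrow> complex" where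
    arc: "\<And>v. v \<in> verts G \<Longrightarrow> arc (\<gamma> v)" and
    adj: "\<And>u v. u \<in> verts G \<Longrightarrow> v \<in> verts G \<Longrightarrow> u \<noteq> v \<Longrightarrow>
      {u, v} \<in> edges G \<longleftrightarrow> path_image (\<gamma> u) \<inter> path_image (\<gamma> v) \<noteq> {}"
    using assms(1) unfolding string_graph_def by blast
  have G: "simple_graph G" using assms(1) by (simp add: string_graph_def)
  then have finV: "finite (verts G)" and edge: "\<And>e. e \<in> edges G \<Longrightarrow> e \<subseteq> verts G \<and> card e = 2"
    by (simp_all add: simple_graph_def)
  have finE: "finite (edges G)"
    using finV edge by (intro finite_subset[of "edges G" "Pow (verts G)"]) auto
  have J: "finite (verts J)" "\<And>e. e \<in> edges J \<Longrightarrow> e \<subseteq> verts J \<and> card e = 2"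
    using assms(3) by (auto simp: shallow_minor_def simple_graph_def)
  obtain S where S: "\<And>i. i \<in> verts J \<Longrightarrow> S i \<subseteq> verts G"
      "\<And>i. i \<in> verts J \<Longrightarrow> connected_graph (induced_subgraph G (S i))"
      "\<And>i. i \<in> verts J \<Longrightarrow> graph_radius (induced_subgraph G (S i)) \<le> r"
    and dis: "disjoint_family_on S (verts J)"
    and model: "\<And>i j. {i, j} \<in> edges J \<Longrightarrow> \<exists>u\<in>S i. \<exists>v\<in>S j. {u, v} \<in> edges G"
    using assms(3) unfolding shallow_minor_def shallow_model_def is_model_def by blast
  have same: "i = j" if "x \<in> S i" "x \<in> S j" "i \<in> verts J" "j \<in> verts J" for x i j
    using dis that by (auto simp: disjoint_family_on_def)
  let ?I = "\<lambda>x. path_image (\<gamma> x)"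
  have pcI: "path_connected (?I v)" if "v \<in> verts G" for v
    using arc[OF that] by (simp add: arc_imp_path path_connected_path_image)
  have "\<exists>c\<in>S i. \<forall>w\<in>S i. \<exists>p. walk_betw (induced_subgraph G (S i)) c p w \<and> length p \<le> Suc r"
    if i: "i \<in> verts J" for i
  proof -
    have "verts (induced_subgraph G (S i)) = S i"
      using S(1)[OF i] by (auto simp: induced_subgraph_def)
    then show ?thesis
      using walks_from_centre[OF _ S(2,3)[OF i]] S(1)[OF i] finV by (metis finite_subset)
  qed
  then obtain c where c: "\<And>i. i \<in> verts J \<Longrightarrow> c i \<in> S i" and
    walk: "\<And>i w. i \<in> verts J \<Longrightarrow> w \<in> S i \<Longrightarrow>
      \<exists>p. walk_betw (induced_subgraph G (S i)) (c i) p w \<and> length p \<le> Suc r"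
    by metis
  \<comment> \<open>Consecutive strings of a walk meet, so the strings of a walk from the centre
    form a path-connected set.\<close>
  have branch: "\<exists>P \<subseteq> S i. card P \<le> Suc r \<and> c i \<in> P \<and> w \<in> P \<and> path_connected (\<Union>x\<in>P. ?I x)"
    if i: "i \<in> verts J" and w: "w \<in> S i" for i w
  proof -
    obtain p where p: "p \<noteq> []" "hd p = c i" "last p = w" "set p \<subseteq> S i" "length p \<le> Suc r"
      "successively (\<lambda>x y. {x, y} \<in> edges (induced_subgraph G (S i))) p"
      using walk[OF i w] by (auto simp: walk_betw_def induced_subgraph_def)
    have "successively (\<lambda>x y. ?I x \<inter> ?I y \<noteq> {}) p"
    proof (rule successively_mono[OF p(6)])
      fix x y assume "{x, y} \<in> edges (induced_subgraph G (S i))"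
      then have xy: "{x, y} \<in> edges G" by (simp add: induced_subgraph_def)
      then show "?I x \<inter> ?I y \<noteq> {}"
        using edge[OF xy] adj[of x y] by (cases "x = y") auto
    qed
    then have "path_connected (\<Union>x\<in>set p. ?I x)"
      using p(1,4) S(1)[OF i] by (intro path_connected_chain pcI) auto
    moreover have "card (set p) \<le> Suc r"
      using card_length[of p] p(5) by simp
    moreover have "c i \<in> set p" "w \<in> set p"
      using p(1-3) hd_in_set last_in_set by metis+
    ultimately show ?thesis using p(4) by blast
  qed
  \<comment> \<open>Two walks from the centres to the ends of an edge of \<open>G\<close> between
    the branch sets use at most \<open>2 * (r + 1)\<close> strings.\<close>
  have "\<exists>P. P \<subseteq> (\<Union>i\<in>e. S i) \<and> card P \<le> 2 * r + 2 \<and> c ` e \<subseteq> P \<and> path_connected (\<Union>x\<in>P. ?I x)"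
    if e: "e \<in> edges J" for e
  proof -
    obtain i j where ij: "e = {i, j}" "i \<in> verts J" "j \<in> verts J"
      using J(2)[OF e] by (auto simp: card_2_iff)
    obtain u v where uv: "u \<in> S i" "v \<in> S j" "{u, v} \<in> edges G"
      using model e ij(1) by blast
    obtain P where P: "P \<subseteq> S i" "card P \<le> Suc r" "c i \<in> P" "u \<in> P" "path_connected (\<Union>x\<in>P. ?I x)"
      using branch[OF ij(2) uv(1)] by blast
    obtain Q where Q: "Q \<subseteq> S j" "card Q \<le> Suc r" "c j \<in> Q" "v \<in> Q" "path_connected (\<Union>x\<in>Q. ?I x)"
      using branch[OF ij(3) uv(2)] by blast
    have "?I u \<inter> ?I v \<noteq> {}"
      using edge[OF uv(3)] adj[of u v] uv(3) by (cases "u = v") auto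
    then have "(\<Union>x\<in>P. ?I x) \<inter> (\<Union>x\<in>Q. ?I x) \<noteq> {}"
      using P(4) Q(4) by blast
    then have "path_connected (\<Union>x\<in>P \<union> Q. ?I x)"
      using path_connected_Un[OF P(5) Q(5)] by (simp add: UN_Un)
    moreover have "card (P \<union> Q) \<le> 2 * r + 2"
      using card_Un_le[of P Q] P(2) Q(2) by simp
    ultimately show ?thesis
      using P(1,3) Q(1,3) ij(1) by (intro exI[of _ "P \<union> Q"]) auto
  qed
  then obtain P where P: "\<And>e. e \<in> edges J \<Longrightarrow> P e \<subseteq> (\<Union>i\<in>e. S i)"
    "\<And>e. e \<in> edges J \<Longrightarrow> card (P e) \<le> 2 * r + 2" "\<And>e. e \<in> edges J \<Longrightarrow> c ` e \<subseteq> P e"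
    "\<And>e. e \<in> edges J \<Longrightarrow> path_connected (\<Union>x\<in>P e. ?I x)"
    by metis
  have PG: "P e \<subseteq> verts G" if "e \<in> edges J" for e
    using P(1)[OF that] J(2)[OF that] S(1) by blast
  \<comment> \<open>\<open>h e\<close> is the tail of the oriented edge \<open>e\<close>, so
    outdegrees are at most \<open>d\<close>.\<close>
  obtain h where h: "\<And>e. e \<in> edges G \<Longrightarrow> h e \<in> e" "\<And>v. v \<in> verts G \<Longrightarrow> card {e \<in> edges G. h e = v} \<le> d"
    using orientation_exists[OF finE finV edge, of "\<lambda>_. d"]
      card_induced_edges_le[OF G assms(2)] by (auto simp: mult.commute)
  \<comment> \<open>\<open>K e\<close> collects the branch sets hit by an oriented edge of \<open>G\<close> leaving the path \<open>P e\<close>.\<close>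
  define K where "K = (\<lambda>e. {k \<in> verts J - e. \<exists>f\<in>edges G. h f \<in> P e \<and> f \<inter> S k \<noteq> {}})"
  define m where "m = (2 * r + 2) * d"
  have cardK: "card (K e) \<le> m" if e: "e \<in> edges J" for e
  proof -
    have "\<forall>k\<in>K e. \<exists>f. f \<in> edges G \<and> h f \<in> P e \<and> f \<inter> S k \<noteq> {}"
      by (auto simp: K_def)
    from bchoice[OF this] obtain \<phi> where
      \<phi>: "\<forall>k\<in>K e. \<phi> k \<in> edges G \<and> h (\<phi> k) \<in> P e \<and> \<phi> k \<inter> S k \<noteq> {}" ..
    \<comment> \<open>The tail of \<open>\<phi> k\<close> lies in a branch set of an end of
      \<open>e\<close>, so the head is what lies in \<open>S k\<close>; since branch sets are
      disjoint, the head determines \<open>k\<close>.\<close>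
    have "inj_on \<phi> (K e)"
    proof (rule inj_onI)
      fix k l assume kl: "k \<in> K e" "l \<in> K e" "\<phi> k = \<phi> l"
      have "h (\<phi> k) \<in> \<phi> k" "card (\<phi> k) = 2" using bspec[OF \<phi> kl(1)] h(1) edge by auto
      then obtain y where "\<phi> k = {h (\<phi> k), y}"
        by (auto simp: card_2_iff doubleton_eq_iff)
      then obtain x where xy: "h (\<phi> k) = x" "\<phi> k = {x, y}" by blast
      obtain i where i: "i \<in> e" "x \<in> S i" using bspec[OF \<phi> kl(1)] P(1)[OF e] xy(1) by blast
      have v: "i \<in> verts J" "k \<in> verts J" "l \<in> verts J" "i \<noteq> k" "i \<noteq> l"
        using i(1) J(2)[OF e] kl(1,2) by (auto simp: K_def)
      have "x \<notin> S k" "x \<notin> S l"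
        using same[OF i(2)] v by blast+
      moreover have "\<phi> k \<inter> S k \<noteq> {}" "\<phi> k \<inter> S l \<noteq> {}"
        using bspec[OF \<phi> kl(1)] bspec[OF \<phi> kl(2)] kl(3) by simp_all
      ultimately have "y \<in> S k" "y \<in> S l" unfolding xy(2) by blast+
      then show "k = l" using same v(2,3) by blast
    qed
    then have "card (K e) \<le> card (\<Union>x\<in>P e. {f \<in> edges G. h f = x})"
      using \<phi> finE finite_subset[OF PG[OF e] finV] by (intro card_inj_on_le[of \<phi>]) auto
    also have "\<dots> \<le> (\<Sum>x\<in>P e. card {f \<in> edges G. h f = x})"
      using finite_subset[OF PG[OF e] finV] by (rule card_UN_le)
    also have "\<dots> \<le> (\<Sum>x\<in>P e. d)"
      using h(2) PG[OF e] by (intro sum_mono) auto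
    also have "\<dots> \<le> m"
      unfolding m_def sum_constant of_nat_id by (rule mult_le_mono1[OF P(2)[OF e]])
    finally show ?thesis .
  qed
  have sparse: "card {e \<in> edges J. e \<subseteq> X \<and> X \<inter> K e = {}} \<le> 3 * card X" if X: "X \<subseteq> verts J" for X
  proof (cases "X = {}")
    case True
    then have "{e \<in> edges J. e \<subseteq> X \<and> X \<inter> K e = {}} = {}" using J(2) by fastforce
    then show ?thesis by (simp only: card.empty)
  next
    case False
    let ?E = "{e \<in> edges J. e \<subseteq> X \<and> X \<inter> K e = {}}"
    \<comment> \<open>The head \<open>y\<close> lies in a branch set \<open>S k\<close> with
      \<open>k\<close> in \<open>f\<close> and not in \<open>e\<close>. Then \<open>k\<close>
      belongs to both \<open>K e\<close> and \<open>X\<close>, so \<open>e\<close> was not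
      kept.\<close>
    have no_arrow: False
      if e: "e \<in> ?E" and f: "f \<in> ?E" "e \<inter> f = {}"
        and xy: "x \<in> P e" "y \<in> P f" "{x, y} \<in> edges G" "h {x, y} = x" for e f x y
    proof -
      obtain k where k: "k \<in> f" "y \<in> S k" using P(1)[of f] f xy(2) by blast
      have "h {x, y} \<in> P e" "{x, y} \<inter> S k \<noteq> {}" using xy(1,4) k(2) by auto
      moreover have "k \<in> verts J - e" using k(1) f J(2)[of f] by blast
      ultimately have "k \<in> K e" using xy(3) unfolding K_def by blast
      then show False using k(1) e f by blast
    qed
    have "quasi_planar ?E"
      unfolding quasi_planar_def
    \<comment> \<open>A vertex is placed at the start of its central string, and an edge is drawn as
      the whole union of the strings along its path.\<close>
    proof (intro exI[of _ "\<lambda>i. pathstart (\<gamma> (c i))"] exI[of _ "\<lambda>e. \<Union>x\<in>P e. ?I x"] conjI ballI impI)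
      fix e assume e: "e \<in> ?E"
      then show "path_connected (\<Union>x\<in>P e. ?I x)" using P(4) by blast
      show "(\<lambda>i. pathstart (\<gamma> (c i))) ` e \<subseteq> (\<Union>x\<in>P e. ?I x)"
        using P(3)[of e] e by (auto intro!: pathstart_in_path_image)
      fix f assume f: "f \<in> ?E" and ef: "e \<inter> f = {}"
      show "(\<Union>x\<in>P e. ?I x) \<inter> (\<Union>x\<in>P f. ?I x) = {}"
      proof (rule ccontr)
        assume "\<not> ?thesis"
        then obtain x y where xy: "x \<in> P e" "y \<in> P f" "?I x \<inter> ?I y \<noteq> {}" by blast
        obtain i k where ik: "i \<in> e" "x \<in> S i" "k \<in> f" "y \<in> S k"
          using P(1)[of e] P(1)[of f] xy e f by blast
        \<comment> \<open>\<open>adj\<close> speaks of distinct vertices only; here \<open>x\<close>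
          and \<open>y\<close> lie in different branch sets.\<close>
        then have "x \<noteq> y" using same[of x i k] J(2)[of e] J(2)[of f] e f ef by blast
        then have E: "{x, y} \<in> edges G"
          using adj[of x y] xy PG[of e] PG[of f] e f by blast
        then have "h {x, y} = x \<or> h {y, x} = y" using h(1)[OF E] by (auto simp: insert_commute)
        moreover have "{y, x} \<in> edges G" using E by (simp add: insert_commute)
        ultimately show False
          using no_arrow[OF e f ef xy(1,2) E] no_arrow[OF f e _ xy(2,1)] ef by blast
      qed
    qed
    moreover have "finite X" using X J(1) by (rule finite_subset)
    ultimately have "card ?E + 2 \<le> 3 * card X"
      using False J(2) by (intro quasi_planar_card_edges) auto
    then show ?thesis by simp
  qed
  have "real (card (edges J)) \<le> 3 * exp 1 * (real m + 1) * real (card (verts J))"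
  proof (rule card_edges_by_sampling[where K = K])
    show "K e \<subseteq> verts J - e \<and> card (K e) \<le> m" if "e \<in> edges J" for e
      using cardK[OF that] by (auto simp: K_def)
  qed (use J sparse in auto)
  then have "edge_density J \<le> 3 * exp 1 * (real m + 1)"
    unfolding edge_density_eq by (cases "card (verts J) = 0") (simp_all add: divide_le_eq)
  moreover have "real m = (2 * real r + 2) * real d" by (simp add: m_def algebra_simps)
  ultimately show ?thesis by simp
qed

theorem theorem1:
  fixes G :: "'a ugraph" and d r :: nat
  assumes "string_graph G"
    and "max_density G \<le> real d"
  shows "nabla r G \<le> 3 * exp 1 * ((2 * real r + 2) * real d + 1)"
proof -
  have "simple_graph G" using assms(1) by (simp add: string_graph_def)
  then show ?thesis
    unfolding nabla_def
    using shallow_minor_edge_density_le[OF assms] by (subst Max_le_iff[OF nabla_wf]) auto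
qed

end
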